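(* Let $q_{\mathrm s}=q(t_{\mathrm s})$ be a configuration with $\Phi(q_{\mathrm s})=0$, and let $\nu^-=\nu(t_{\mathrm s}^-)\in\mathbb{R}^6$ be a pre-impact velocity for which there is a solution $(z,\mu)$ of the distance problem at $q_{\mathrm s}$ with $n(z,\mu,q_{\mathrm s})^\top\nu^-<0$. Consider the impact law: find $\nu^+\in\mathbb{R}^6$, $\Lambda_{\mathrm n}\ge0$ and $(z_{\mathrm I},\mu_{\mathrm I})$ solving the distance problem at $q_{\mathrm s}$ such that $$\nu^+=\nu^-+M^{-1}n(z_{\mathrm I},\mu_{\mathrm I},q_{\mathrm s})\Lambda_{\mathrm n},\qquad 0=n(z_{\mathrm I},\mu_{\mathrm I},q_{\mathrm s})^\top\nu^+,$$ $$0\le n(\hat z_{\mathrm I},\hat\mu_{\mathrm I},q_{\mathrm s})^\top\nu^+\quad\text{for all }(\hat z_{\mathrm I},\hat\mu_{\mathrm I})\text{ solving the distance problem at }q_{\mathrm s}.$$ Then the post-impact velocity $\nu^+$ is unique, and $z_{\mathrm I}$, in particular its component $p_{\mathrm I}$ (the equivalent contact point for impact resolution), is also unique.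
   Context: Setting. For $i=1,2$, $\mathcal{P}_i=\{x\in\mathbb{R}^2: A_ix\le b_i\}$ is a (bounded) planar polytope, with $A_i\in\mathbb{R}^{n_{i,\mathrm h}\times 2}$ and $b_i\in\mathbb{R}^{n_{i,\mathrm h}}$. The rows of $A_i$ have Euclidean norm one. The scalar $r>0$ satisfies $b_i-\mathbf{1}r>0$ componentwise ($\mathbf 1$ is the all-ones vector). The polytopes are assumed non-degenerate: two distinct halfspace constraints of the same body that are active at an optimal point of the distance problem below with positive multipliers have linearly independent normals. $R(\theta)=\begin{pmatrix}\cos\theta&-\sin\theta\\ \sin\theta&\cos\theta\end{pmatrix}$, and $a\times b=a_1b_2-a_2b_1$ for $a,b\in\mathbb{R}^2$. Configuration $q=(c_1,\xi_1,c_2,\xi_2)\in\mathbb{R}^6$ ($c_i\in\mathbb{R}^2$, $\xi_i\in\mathbb{R}$); velocity $\nu\in\mathbb{R}^6$. The inertia matrix $M\in\mathbb{R}^{6\times6}$ is diagonal and positive definite. Distance problem at $q$: $\Phi(q)=\min_{z}\ \alpha-1$ over $z=(p,\alpha,y_1,y_2)\in\mathbb{R}^2\times\mathbb{R}\times\mathbb{R}^2\times\mathbb{R}^2$ subject to $A_1R(\xi_1)^\top(y_1-c_1)\le\alpha b_1-\mathbf1r$, $A_2R(\xi_2)^\top(y_2-c_2)\le\alpha b_2-\mathbf1r$, $(p-y_1)^\top(p-y_1)\le r^2$, $(p-y_2)^\top(p-y_2)\le r^2$, with nonnegative Lagrange multipliers $\mu=(\mu_{1,\mathrm p},\mu_{2,\mathrm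 p},\mu_{1,\mathrm c},\mu_{2,\mathrm c})$ in the order of the constraints. "$(z,\mu)$ solves the distance problem at $q$" means that $z$ is primal optimal and $\mu$ dual optimal (the Karush-Kuhn-Tucker conditions hold). The optimal $\mu$ is unique whenever $c_1\ne c_2$. Contact normal: $$n(z,\mu,q)=\begin{pmatrix}n_{\mathrm{tr}}\\(p-c_1)\times n_{\mathrm{tr}}\\-n_{\mathrm{tr}}\\-(p-c_2)\times n_{\mathrm{tr}}\end{pmatrix}\in\mathbb{R}^6,\qquad n_{\mathrm{tr}}=-R(\xi_1)A_1^\top\mu_{1,\mathrm p}.$$ *)

theory Defs
  imports "HOL-Analysis.Analysis"
begin

lemma vector_6 [simp]:
  fixes a b c d e f :: "'a::zero"
  shows "(vector [a, b, c, d, e, f] :: 'a^6) $ 1 = a"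
    "(vector [a, b, c, d, e, f] :: 'a^6) $ 2 = b"
    "(vector [a, b, c, d, e, f] :: 'a^6) $ 3 = c"
    "(vector [a, b, c, d, e, f] :: 'a^6) $ 4 = d"
    "(vector [a, b, c, d, e, f] :: 'a^6) $ 5 = e"
    "(vector [a, b, c, d, e, f] :: 'a^6) $ 6 = f"
  by (simp_all add: vector_def)

definition rot :: "real \<Rightarrow> real^2^2" where
  "rot \<theta> = vector [vector [cos \<theta>, - sin \<theta>], vector [sin \<theta>, cos \<theta>]]"

definition cross2 :: "real^2 \<Rightarrow> real^2 \<Rightarrow> real" where
  "cross2 a b = a$1 * b$2 - a$2 * b$1"

(* A configuration is q = (c1, xi1, c2, xi2), stacked into real^6. *)
definition center1 :: "real^6 \<Rightarrow> real^2" where "center1 q = vector [q$1, q$2]"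
definition angle1 :: "real^6 \<Rightarrow> real" where "angle1 q = q$3"
definition center2 :: "real^6 \<Rightarrow> real^2" where "center2 q = vector [q$4, q$5]"
definition angle2 :: "real^6 \<Rightarrow> real" where "angle2 q = q$6"

(* Primal variable z = (p, alpha, y1, y2). *)
type_synonym primal = "(real^2) \<times> real \<times> (real^2) \<times> (real^2)"

(* Multipliers mu = (mu_1p, mu_2p, mu_1c, mu_2c). *)
type_synonym ('m, 'n) multiplier = "(real^'m) \<times> (real^'n) \<times> real \<times> real"

(* The constraints of the distance problem have the form
   halfspace_residual ... <= 0 (componentwise) and ball_residual ... <= 0. *)
definition halfspace_residual ::
  "real^2^'m \<Rightarrow> real^'m \<Rightarrow> real \<Rightarrow> real^2 \<Rightarrow> real \<Rightarrow> real \<Rightarrow> real^2 \<Rightarrow> real^'m" where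
  "halfspace_residual A b r c \<xi> \<alpha> y =
     A *v (transpose (rot \<xi>) *v (y - c)) - (\<alpha> *\<^sub>R b - vec r)"

definition ball_residual :: "real \<Rightarrow> real^2 \<Rightarrow> real^2 \<Rightarrow> real" where
  "ball_residual r p y = (p - y) \<bullet> (p - y) - r\<^sup>2"

definition objective :: "primal \<Rightarrow> real" where
  "objective = (\<lambda>(p, \<alpha>, y1, y2). \<alpha> - 1)"

definition feasible ::
  "real^2^'m \<Rightarrow> real^'m \<Rightarrow> real^2^'n \<Rightarrow> real^'n \<Rightarrow> real \<Rightarrow> real^6 \<Rightarrow> primal set" where
  "feasible A1 b1 A2 b2 r q = {(p, \<alpha>, y1, y2).
     halfspace_residual A1 b1 r (center1 q) (angle1 q) \<alpha> y1 \<le> 0 \<and>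
     halfspace_residual A2 b2 r (center2 q) (angle2 q) \<alpha> y2 \<le> 0 \<and>
     ball_residual r p y1 \<le> 0 \<and> ball_residual r p y2 \<le> 0}"

definition \<Phi> ::
  "real^2^'m \<Rightarrow> real^'m \<Rightarrow> real^2^'n \<Rightarrow> real^'n \<Rightarrow> real \<Rightarrow> real^6 \<Rightarrow> real" where
  "\<Phi> A1 b1 A2 b2 r q = (INF z \<in> feasible A1 b1 A2 b2 r q. objective z)"

definition primal_optimal ::
  "real^2^'m \<Rightarrow> real^'m \<Rightarrow> real^2^'n \<Rightarrow> real^'n \<Rightarrow> real \<Rightarrow> real^6 \<Rightarrow> primal \<Rightarrow> bool" where
  "primal_optimal A1 b1 A2 b2 r q z \<longleftrightarrow>
     z \<in> feasible A1 b1 A2 b2 r q \<and>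
     (\<forall>z' \<in> feasible A1 b1 A2 b2 r q. objective z \<le> objective z')"

definition lagrangian ::
  "real^2^'m \<Rightarrow> real^'m \<Rightarrow> real^2^'n \<Rightarrow> real^'n \<Rightarrow> real \<Rightarrow> real^6 \<Rightarrow>
   primal \<Rightarrow> ('m, 'n) multiplier \<Rightarrow> real" where
  "lagrangian A1 b1 A2 b2 r q = (\<lambda>(p, \<alpha>, y1, y2) (\<mu>1p, \<mu>2p, \<mu>1c, \<mu>2c).
     objective (p, \<alpha>, y1, y2)
     + \<mu>1p \<bullet> halfspace_residual A1 b1 r (center1 q) (angle1 q) \<alpha> y1
     + \<mu>2p \<bullet> halfspace_residual A2 b2 r (center2 q) (angle2 q) \<alpha> y2
     + \<mu>1c * ball_residual r p y1 + \<mu>2c * ball_residual r p y2)"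

definition multiplier_nonneg :: "('m::finite, 'n::finite) multiplier \<Rightarrow> bool" where
  "multiplier_nonneg = (\<lambda>(\<mu>1p, \<mu>2p, \<mu>1c, \<mu>2c). 0 \<le> \<mu>1p \<and> 0 \<le> \<mu>2p \<and> 0 \<le> \<mu>1c \<and> 0 \<le> \<mu>2c)"

(* Extended-real valued: the Lagrangian may be unbounded below in z. *)
definition dual_function ::
  "real^2^'m \<Rightarrow> real^'m \<Rightarrow> real^2^'n \<Rightarrow> real^'n \<Rightarrow> real \<Rightarrow> real^6 \<Rightarrow>
   ('m, 'n) multiplier \<Rightarrow> ereal" where
  "dual_function A1 b1 A2 b2 r q \<mu> = (INF z. ereal (lagrangian A1 b1 A2 b2 r q z \<mu>))"

definition dual_optimal ::
  "real^2^'m \<Rightarrow> real^'m \<Rightarrow> real^2^'n \<Rightarrow> real^'n \<Rightarrow> real \<Rightarrow> real^6 \<Rightarrow>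
   ('m, 'n) multiplier \<Rightarrow> bool" where
  "dual_optimal A1 b1 A2 b2 r q \<mu> \<longleftrightarrow>
     multiplier_nonneg \<mu> \<and>
     (\<forall>\<mu>'. multiplier_nonneg \<mu>' \<longrightarrow>
        dual_function A1 b1 A2 b2 r q \<mu>' \<le> dual_function A1 b1 A2 b2 r q \<mu>)"

definition complementary ::
  "real^2^'m \<Rightarrow> real^'m \<Rightarrow> real^2^'n \<Rightarrow> real^'n \<Rightarrow> real \<Rightarrow> real^6 \<Rightarrow>
   primal \<Rightarrow> ('m, 'n) multiplier \<Rightarrow> bool" where
  "complementary A1 b1 A2 b2 r q = (\<lambda>(p, \<alpha>, y1, y2) (\<mu>1p, \<mu>2p, \<mu>1c, \<mu>2c).
     (\<forall>i. \<mu>1p$i * halfspace_residual A1 b1 r (center1 q) (angle1 q) \<alpha> y1 $ i = 0) \<and>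
     (\<forall>j. \<mu>2p$j * halfspace_residual A2 b2 r (center2 q) (angle2 q) \<alpha> y2 $ j = 0) \<and>
     \<mu>1c * ball_residual r p y1 = 0 \<and> \<mu>2c * ball_residual r p y2 = 0)"

definition kkt ::
  "real^2^'m \<Rightarrow> real^'m \<Rightarrow> real^2^'n \<Rightarrow> real^'n \<Rightarrow> real \<Rightarrow> real^6 \<Rightarrow>
   primal \<Rightarrow> ('m, 'n) multiplier \<Rightarrow> bool" where
  "kkt A1 b1 A2 b2 r q z \<mu> \<longleftrightarrow>
     ((\<lambda>z'. lagrangian A1 b1 A2 b2 r q z' \<mu>) has_derivative (\<lambda>_. 0)) (at z) \<and>
     z \<in> feasible A1 b1 A2 b2 r q \<and> multiplier_nonneg \<mu> \<and>
     complementary A1 b1 A2 b2 r q z \<mu>"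

(* The three conditions are spelled out side by side; since the problem is convex,
   kkt implies the other two. *)
definition solves ::
  "real^2^'m \<Rightarrow> real^'m \<Rightarrow> real^2^'n \<Rightarrow> real^'n \<Rightarrow> real \<Rightarrow> real^6 \<Rightarrow>
   primal \<Rightarrow> ('m, 'n) multiplier \<Rightarrow> bool" where
  "solves A1 b1 A2 b2 r q z \<mu> \<longleftrightarrow>
     primal_optimal A1 b1 A2 b2 r q z \<and> dual_optimal A1 b1 A2 b2 r q \<mu> \<and>
     kkt A1 b1 A2 b2 r q z \<mu>"

(* The inequality of the two rows is needed because the family of normals is turned into
   a set, and the singleton {a} is independent for a nonzero a. *)
definition active_rows_independent :: "real^2^'m \<Rightarrow> real^'m \<Rightarrow> real^'m \<Rightarrow> bool" where
  "active_rows_independent A g \<mu> \<longleftrightarrow>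
     (\<forall>i j. i \<noteq> j \<longrightarrow> g$i = 0 \<longrightarrow> g$j = 0 \<longrightarrow> 0 < \<mu>$i \<longrightarrow> 0 < \<mu>$j \<longrightarrow>
        row i A \<noteq> row j A \<and> independent {row i A, row j A})"

definition nondegenerate ::
  "real^2^'m \<Rightarrow> real^'m \<Rightarrow> real^2^'n \<Rightarrow> real^'n \<Rightarrow> real \<Rightarrow> real^6 \<Rightarrow> bool" where
  "nondegenerate A1 b1 A2 b2 r q \<longleftrightarrow>
     (\<forall>p \<alpha> y1 y2 \<mu>1p \<mu>2p \<mu>1c \<mu>2c.
        solves A1 b1 A2 b2 r q (p, \<alpha>, y1, y2) (\<mu>1p, \<mu>2p, \<mu>1c, \<mu>2c) \<longrightarrow>
        active_rows_independent A1
          (halfspace_residual A1 b1 r (center1 q) (angle1 q) \<alpha> y1) \<mu>1p \<and>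
        active_rows_independent A2
          (halfspace_residual A2 b2 r (center2 q) (angle2 q) \<alpha> y2) \<mu>2p)"

definition n_tr :: "real^2^'m \<Rightarrow> ('m, 'n) multiplier \<Rightarrow> real^6 \<Rightarrow> real^2" where
  "n_tr A1 = (\<lambda>(\<mu>1p, \<mu>2p, \<mu>1c, \<mu>2c) q. - (rot (angle1 q) *v (transpose A1 *v \<mu>1p)))"

definition contact_normal ::
  "real^2^'m \<Rightarrow> primal \<Rightarrow> ('m, 'n) multiplier \<Rightarrow> real^6 \<Rightarrow> real^6" where
  "contact_normal A1 z \<mu> q =
     (let p = fst z; t = n_tr A1 \<mu> q in
      vector [t$1, t$2, cross2 (p - center1 q) t,
              - t$1, - t$2, - cross2 (p - center2 q) t])"

definition diagonal_posdef :: "real^'k^'k \<Rightarrow> bool" where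
  "diagonal_posdef M \<longleftrightarrow>
     (\<forall>i j. i \<noteq> j \<longrightarrow> M$i$j = 0) \<and> (\<forall>x. x \<noteq> 0 \<longrightarrow> 0 < x \<bullet> (M *v x))"

definition impact_law ::
  "real^2^'m \<Rightarrow> real^'m \<Rightarrow> real^2^'n \<Rightarrow> real^'n \<Rightarrow> real \<Rightarrow> real^6^6 \<Rightarrow> real^6 \<Rightarrow> real^6 \<Rightarrow>
   real^6 \<Rightarrow> real \<Rightarrow> primal \<Rightarrow> ('m, 'n) multiplier \<Rightarrow> bool" where
  "impact_law A1 b1 A2 b2 r M q \<nu>_pre \<nu>_post \<Lambda> z \<mu> \<longleftrightarrow>
     0 \<le> \<Lambda> \<and> solves A1 b1 A2 b2 r q z \<mu> \<and>
     \<nu>_post = \<nu>_pre + \<Lambda> *\<^sub>R (matrix_inv M *v contact_normal A1 z \<mu> q) \<and>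
     0 = contact_normal A1 z \<mu> q \<bullet> \<nu>_post \<and>
     (\<forall>z' \<mu>'. solves A1 b1 A2 b2 r q z' \<mu>' \<longrightarrow> 0 \<le> contact_normal A1 z' \<mu>' q \<bullet> \<nu>_post)"

end

theory Submission
  imports Defs
begin

text \<open>
  Every solution of the distance problem has the form \<open>(p, 1, p - u1, p - u2)\<close> with the same
  \<open>u1\<close> and \<open>u2\<close>; the optimal \<open>p\<close> form a compact convex set orthogonal to \<open>u1\<close>, and every
  \<open>n_tr\<close> is a positive multiple of \<open>- u1\<close>, hence nonzero. Since the normal is affine in \<open>p\<close>,
  the contact normals generate a closed convex cone, and the law says that the post-impact
  velocity is the projection, in the inertia metric, of the pre-impact velocity onto the dual
  of this cone. This gives existence and uniqueness of the velocity and of the impulse. Equality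
  of two impulses forces the difference of their contact points to be parallel to \<open>u1\<close>, while
  optimality makes it orthogonal to \<open>u1\<close>. The multipliers themselves need not be unique, but
  they only affect the scale of the normal, which the impulse magnitude absorbs.
\<close>

section \<open>Projection onto a cone in the inertia metric\<close>

lemma matrix_inv_unique:
  fixes A B :: "'a::semiring_1^'n^'n"
  assumes "A ** B = mat 1" "B ** A = mat 1"
  shows "matrix_inv A = B"
proof -
  have "A ** matrix_inv A = mat 1 \<and> matrix_inv A ** A = mat 1"
    unfolding matrix_inv_def by (rule someI_ex) (use assms in blast)
  then show ?thesis
    by (metis assms(2) matrix_mul_assoc matrix_mul_lid matrix_mul_rid)
qed

lemma diagonal_matrix_vector_mult:
  assumes "\<And>i j. i \<noteq> j \<Longrightarrow> M $ i $ j = 0"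
  shows "(M *v x) $ i = M $ i $ i * x $ i"
proof -
  have "(M *v x) $ i = (\<Sum>j\<in>UNIV. M $ i $ j * x $ j)"
    by (simp add: matrix_vector_mult_def)
  also have "\<dots> = (\<Sum>j\<in>UNIV. if j = i then M $ i $ i * x $ i else 0)"
    by (rule sum.cong) (use assms in auto)
  finally show ?thesis by simp
qed

text \<open>Entrywise division by the square roots of the positive diagonal entries. Splitting the
  inverse of \<open>M\<close> into two equal self-adjoint factors turns projection in the inertia
  metric into Euclidean projection, where \<open>closest_point\<close> applies.\<close>

lemma diagonal_posdef_inv_sqrt:
  fixes M :: "real^'k^'k"
  assumes "diagonal_posdef M"
  obtains S :: "real^'k \<Rightarrow> real^'k"
  where "linear S" "inj S" "\<And>x y. S x \<bullet> y = x \<bullet> S y"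
    "\<And>x. matrix_inv M *v x = S (S x)"
proof -
  have off: "M $ i $ j = 0" if "i \<noteq> j" for i j
    using assms that by (auto simp: diagonal_posdef_def)
  have pos: "0 < M $ i $ i" for i
  proof -
    have "0 < axis i 1 \<bullet> (M *v axis i 1)"
      using assms by (auto simp: diagonal_posdef_def axis_eq_0_iff)
    also have "\<dots> = M $ i $ i"
      by (simp add: inner_axis' diagonal_matrix_vector_mult[OF off])
    finally show ?thesis .
  qed
  define S :: "real^'k \<Rightarrow> real^'k" where "S x = (\<chi> i. x $ i / sqrt (M $ i $ i))" for x
  define B :: "real^'k^'k" where "B = (\<chi> i j. if i = j then inverse (M $ i $ i) else 0)"
  have Boff: "B $ i $ j = 0" if "i \<noteq> j" for i j
    using that by (simp add: B_def)
  have Bdiag: "B $ i $ i = inverse (M $ i $ i)" for i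
    by (simp add: B_def)
  have "matrix_inv M = B"
  proof (rule matrix_inv_unique)
    have "(M ** B) *v x = mat 1 *v x" for x
      using pos by (simp flip: matrix_vector_mul_assoc
        add: vec_eq_iff diagonal_matrix_vector_mult[OF off] diagonal_matrix_vector_mult[OF Boff] Bdiag
             less_imp_neq[symmetric])
    then show "M ** B = mat 1" by (metis matrix_eq)
    have "(B ** M) *v x = mat 1 *v x" for x
      using pos by (simp flip: matrix_vector_mul_assoc
        add: vec_eq_iff diagonal_matrix_vector_mult[OF off] diagonal_matrix_vector_mult[OF Boff] Bdiag
             less_imp_neq[symmetric])
    then show "B ** M = mat 1" by (metis matrix_eq)
  qed
  moreover have "B *v x = S (S x)" for x
    using pos by (simp add: vec_eq_iff S_def diagonal_matrix_vector_mult[OF Boff] Bdiag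
        divide_simps less_imp_le)
  ultimately have "matrix_inv M *v x = S (S x)" for x
    by simp
  moreover have "linear S"
    by (rule linearI) (auto simp: S_def vec_eq_iff add_divide_distrib)
  moreover have "inj S"
    using pos by (auto simp: inj_def S_def vec_eq_iff less_imp_neq[symmetric])
  moreover have "S x \<bullet> y = x \<bullet> S y" for x y
    by (simp add: S_def inner_vec_def)
  ultimately show ?thesis using that by blast
qed

text \<open>With \<open>v = - S a\<close>, the vector \<open>v + \<Lambda> *\<^sub>R S (S k)\<close>
  is \<open>- S (a - w)\<close>, where \<open>w\<close> is the Euclidean projection of
  \<open>a\<close> onto the cone over the image of \<open>K\<close> under \<open>S\<close>; the
  claims are then its variational inequality. Compactness of \<open>K\<close> and
  \<open>0 \<notin> K\<close> make that cone closed. Since \<open>w\<close> may be 0, orthogonality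
  to \<open>k\<close> carries the factor \<open>\<Lambda>\<close>.\<close>

lemma impulse_exists:
  fixes v :: "'a::euclidean_space" and S :: "'a \<Rightarrow> 'a"
  assumes S: "linear S" "inj S" "\<And>x y. S x \<bullet> y = x \<bullet> S y"
    and K: "compact K" "convex K" "0 \<notin> K" "K \<noteq> {}"
  obtains \<Lambda> k where "0 \<le> \<Lambda>" "k \<in> K" "\<Lambda> * (k \<bullet> (v + \<Lambda> *\<^sub>R S (S k))) = 0"
    "\<And>k'. k' \<in> K \<Longrightarrow> 0 \<le> k' \<bullet> (v + \<Lambda> *\<^sub>R S (S k))"
proof -
  interpret linear S by fact
  have "surj S" using S by (simp add: linear_injective_imp_surjective)
  then obtain a where a: "S a = - v" by (metis surjD)
  define C where "C = conic hull (S ` K)"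
  have "compact (S ` K)"
    using K(1) S(1) by (intro compact_continuous_image linear_continuous_on)
      (auto simp: linear_conv_bounded_linear)
  moreover have "0 \<notin> S ` K"
    using K(3) S(2) by (auto simp: inj_def) (metis zero)
  ultimately have "closed C" by (simp add: C_def closed_conic_hull)
  have "convex C"
    unfolding C_def using K(2) S(1) by (intro convex_conic_hull convex_linear_image)
  have C: "C = {c *\<^sub>R S x | c x. 0 \<le> c \<and> x \<in> K}"
    unfolding C_def conic_hull_explicit by blast
  then have "C \<noteq> {}" using K(4) by force
  define w where "w = closest_point C a"
  have wC: "w \<in> C"
    unfolding w_def using \<open>closed C\<close> \<open>C \<noteq> {}\<close> by (rule closest_point_in_set)
  then obtain \<Lambda> k where w: "0 \<le> \<Lambda>" "k \<in> K" "w = \<Lambda> *\<^sub>R S k" using C by blast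
  have opt: "(a - w) \<bullet> (y - w) \<le> 0" if "y \<in> C" for y
    unfolding w_def using \<open>convex C\<close> \<open>closed C\<close> that by (rule closest_point_dot)
  have conic: "conic C" by (simp add: C_def conic_conic_hull)
  \<comment> \<open>The cone contains both \<open>2 *\<^sub>R w\<close> and 0; testing against them
    bounds the inner product with \<open>w\<close> from both sides.\<close>
  have "(a - w) \<bullet> (2 *\<^sub>R w - w) \<le> 0"
    using conic wC by (intro opt) (auto simp: conic_def)
  moreover have "(a - w) \<bullet> (0 *\<^sub>R w - w) \<le> 0"
    using conic wC unfolding conic_def by (intro opt) blast
  ultimately have orth: "(a - w) \<bullet> w = 0" by (simp add: scaleR_2)
  have Sw: "(a - w) \<bullet> S x = - (x \<bullet> (v + \<Lambda> *\<^sub>R S (S k)))" for x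
  proof -
    have "(a - w) \<bullet> S x = S (a - w) \<bullet> x" by (simp add: S(3))
    also have "S (a - w) = - (v + \<Lambda> *\<^sub>R S (S k))"
      by (simp add: diff a w(3) scale)
    also have "\<dots> \<bullet> x = - (x \<bullet> (v + \<Lambda> *\<^sub>R S (S k)))"
      unfolding inner_minus_left by (simp only: inner_commute)
    finally show ?thesis .
  qed
  show ?thesis
  proof
    show "\<Lambda> * (k \<bullet> (v + \<Lambda> *\<^sub>R S (S k))) = 0"
      using orth Sw[of k] by (simp add: w(3))
    fix k' assume "k' \<in> K"
    then have "S k' \<in> C" unfolding C by (force intro: exI[of _ 1])
    from opt[OF this] orth Sw[of k'] show "0 \<le> k' \<bullet> (v + \<Lambda> *\<^sub>R S (S k))"
      by (simp add: inner_diff_right)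
  qed (use w in auto)
qed

section \<open>Contact wrenches\<close>

lemma exhaust_6: "x = 1 \<or> x = 2 \<or> x = 3 \<or> x = 4 \<or> x = 5 \<or> x = 6" for x :: 6
proof (induct x)
  case (of_int z)
  then have "z = 0 \<or> z = 1 \<or> z = 2 \<or> z = 3 \<or> z = 4 \<or> z = 5" by fastforce
  then show ?case by auto
qed

lemma vec6_eqI:
  fixes x y :: "'a^6"
  assumes "x $ 1 = y $ 1" "x $ 2 = y $ 2" "x $ 3 = y $ 3"
    "x $ 4 = y $ 4" "x $ 5 = y $ 5" "x $ 6 = y $ 6"
  shows "x = y"
proof -
  have "x $ i = y $ i" for i using exhaust_6[of i] assms by auto
  then show ?thesis by (simp add: vec_eq_iff)
qed

text \<open>The multiplier enters the contact normal only through \<open>n_tr\<close>. Isolating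
  that direction as \<open>t\<close> leaves a map that is linear in \<open>t\<close> and, for fixed
  \<open>t\<close>, affine in \<open>p\<close>.\<close>

definition wrench :: "real^2 \<Rightarrow> real^2 \<Rightarrow> real^2 \<Rightarrow> real^2 \<Rightarrow> real^6" where
  "wrench c1 c2 t p =
     vector [t$1, t$2, cross2 (p - c1) t, - t$1, - t$2, - cross2 (p - c2) t]"

lemma contact_normal_eq_wrench:
  "contact_normal A1 z \<mu> q = wrench (center1 q) (center2 q) (n_tr A1 \<mu> q) (fst z)"
  by (simp add: contact_normal_def wrench_def Let_def)

lemma wrench_scaleR: "wrench c1 c2 (s *\<^sub>R t) p = s *\<^sub>R wrench c1 c2 t p"
  by (rule vec6_eqI) (simp_all add: wrench_def cross2_def algebra_simps)

text \<open>Moving the contact point alters only the two torques, by opposite amounts. This affine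
  form carries compactness and convexity from points to wrenches.\<close>

lemma wrench_shift:
  "wrench c1 c2 t p = wrench c1 c2 t 0 + cross2 p t *\<^sub>R (axis 3 1 - axis 6 1)"
  by (rule vec6_eqI) (simp_all add: wrench_def cross2_def axis_def algebra_simps)

lemma linear_cross2_left: "linear (\<lambda>p. cross2 p t)"
  by (rule linearI) (simp_all add: cross2_def algebra_simps)

lemma cross2_scaleR_right: "cross2 p (s *\<^sub>R t) = s * cross2 p t"
  by (simp add: cross2_def algebra_simps)

lemma wrench_eq_0D:
  assumes "wrench c1 c2 t p = 0"
  shows "t = 0"
proof -
  have "wrench c1 c2 t p $ 1 = 0" "wrench c1 c2 t p $ 2 = 0" using assms by auto
  then show ?thesis by (simp add: wrench_def vec_eq_iff forall_2)
qed

text \<open>The translational entries recover the force, but the torque recovers the point only up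
  to sliding along the line of action.\<close>

lemma wrench_inj:
  assumes "wrench c1 c2 t p = wrench c1 c2 t' p'"
  shows "t = t'" "cross2 (p - p') t = 0"
proof -
  have *: "wrench c1 c2 t p $ i = wrench c1 c2 t' p' $ i" for i using assms by simp
  show "t = t'" using *[of 1] *[of 2] by (simp add: wrench_def vec_eq_iff forall_2)
  then show "cross2 (p - p') t = 0"
    using *[of 3] by (simp add: wrench_def cross2_def algebra_simps)
qed

lemma compact_wrench_image:
  assumes "compact P" shows "compact (wrench c1 c2 t ` P)"
proof -
  have "continuous_on P (\<lambda>p. wrench c1 c2 t p)"
    by (subst wrench_shift) (auto simp: cross2_def intro!: continuous_intros)
  then show ?thesis using assms by (rule compact_continuous_image)
qed

lemma convex_wrench_image:
  assumes "convex P" shows "convex (wrench c1 c2 t ` P)"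
proof -
  have lin: "linear (\<lambda>p. cross2 p t *\<^sub>R (axis 3 1 - axis 6 1 :: real^6))"
    using linear_compose[OF linear_cross2_left linear_scaleR_left] by (simp add: o_def)
  have "wrench c1 c2 t ` P =
      (\<lambda>p. wrench c1 c2 t 0 + cross2 p t *\<^sub>R (axis 3 1 - axis 6 1)) ` P"
    by (rule image_cong[OF refl]) (rule wrench_shift)
  also have "\<dots> =
      (+) (wrench c1 c2 t 0) ` (\<lambda>p. cross2 p t *\<^sub>R (axis 3 1 - axis 6 1)) ` P"
    by (simp add: image_image)
  finally show ?thesis
    using convex_translation[OF convex_linear_image[OF lin assms]] by simp
qed

text \<open>Lagrange's identity in the plane: a vector both parallel and orthogonal to a nonzero
  \<open>t\<close> vanishes.\<close>

lemma cross2_inner_eq_0: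
  assumes "cross2 w t = 0" "w \<bullet> t = 0" "t \<noteq> 0"
  shows "w = 0"
proof -
  have "(w \<bullet> w) * (t \<bullet> t) = (cross2 w t)\<^sup>2 + (w \<bullet> t)\<^sup>2"
    by (simp add: cross2_def inner_vec_def sum_2 power2_eq_square algebra_simps)
  then show ?thesis using assms by simp
qed

section \<open>Stationarity in the distance problem\<close>

lemma rot_transpose_mult: "rot \<xi> *v (transpose (rot \<xi>) *v w) = w"
proof -
  have "cos \<xi> * (cos \<xi> * a) + sin \<xi> * (sin \<xi> * a) = ((cos \<xi>)\<^sup>2 + (sin \<xi>)\<^sup>2) * a" for a
    unfolding power2_eq_square by (simp only: algebra_simps)
  then have pyth: "cos \<xi> * (cos \<xi> * a) + sin \<xi> * (sin \<xi> * a) = a" for a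
    by simp
  show ?thesis
    by (simp add: rot_def vec_eq_iff forall_2 matrix_vector_mult_def vector_matrix_mult_def
        sum_2 algebra_simps del: transpose_matrix_vector)
      (simp add: transpose_def algebra_simps pyth)
qed

text \<open>This is the gradient in \<open>y\<close> of
  \<open>m \<bullet> halfspace_residual A b r c \<xi> \<alpha> y\<close>; for the first body it is
  the negative of \<open>n_tr\<close>.\<close>

definition force :: "real^2^'m \<Rightarrow> real \<Rightarrow> real^'m \<Rightarrow> real^2" where
  "force A \<xi> m = rot \<xi> *v (transpose A *v m)"

lemma inner_rotated_mult:
  "m \<bullet> (A *v (transpose (rot \<xi>) *v w)) = force A \<xi> m \<bullet> w"
proof -
  have "m \<bullet> (A *v (transpose (rot \<xi>) *v w)) = (m v* A) \<bullet> (transpose (rot \<xi>) *v w)"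
    by (simp only: dot_lmul_matrix)
  also have "\<dots> = (w v* rot \<xi>) \<bullet> (m v* A)"
    by (simp add: inner_commute)
  also have "\<dots> = w \<bullet> force A \<xi> m"
    by (simp add: dot_lmul_matrix force_def)
  finally show ?thesis by (simp add: inner_commute)
qed

lemma inner_halfspace_residual:
  "m \<bullet> halfspace_residual A b r c \<xi> \<alpha> y =
     force A \<xi> m \<bullet> (y - c) - \<alpha> * (m \<bullet> b) + r * (\<Sum>i\<in>UNIV. m $ i)"
proof -
  have "m \<bullet> vec r = r * (\<Sum>i\<in>UNIV. m $ i)"
    by (simp add: inner_vec_def sum_distrib_left mult.commute)
  then show ?thesis
    by (simp add: halfspace_residual_def inner_diff_right[of m] inner_rotated_mult
        del: transpose_matrix_vector)
qed

lemma halfspace_residual_nth: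
  "halfspace_residual A b r c \<xi> \<alpha> y $ i = force A \<xi> (axis i 1) \<bullet> (y - c) - \<alpha> * b $ i + r"
proof -
  have "(\<Sum>j\<in>UNIV. axis i (1::real) $ j) = 1"
    by (simp add: axis_def)
  then show ?thesis
    using inner_halfspace_residual[of "axis i 1" A b r c \<xi> \<alpha> y] by (simp add: inner_axis')
qed

lemma inner_eq_0_componentwise:
  fixes m g :: "real^'k"
  assumes "0 \<le> m" "g \<le> 0" "0 \<le> m \<bullet> g"
  shows "m $ i * g $ i = 0"
proof -
  have le: "m $ i * g $ i \<le> 0" for i
    using assms(1,2) by (auto simp: less_eq_vec_def intro: mult_nonneg_nonpos)
  have "(\<Sum>i\<in>UNIV. m $ i * g $ i) = 0"
    using assms(3) le by (intro antisym sum_nonpos) (auto simp: inner_vec_def)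
  then show ?thesis
    using le sum_nonneg_eq_0_iff[of UNIV "\<lambda>i. - (m $ i * g $ i)"] by (simp add: sum_negf)
qed

lemma inner_nonneg_nonpos:
  fixes m g :: "real^'k"
  assumes "0 \<le> m" "g \<le> 0"
  shows "m \<bullet> g \<le> 0"
  unfolding inner_vec_def using assms
  by (auto simp: less_eq_vec_def intro!: sum_nonpos mult_nonneg_nonpos)

lemma inner_complementary:
  fixes m g :: "real^'k"
  assumes "\<forall>i. m $ i * g $ i = 0"
  shows "m \<bullet> g = 0"
  unfolding inner_vec_def using assms by (simp only: inner_real_def sum.neutral_const)

text \<open>The origin of a body is strictly inside its core polytope, so active constraints
  cannot balance each other.\<close>
lemma force_eq_0D:
  assumes "force A \<xi> m = 0" "0 \<le> m" "\<forall>i. 0 < (b - vec r) $ i"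
    and "\<forall>i. m $ i * halfspace_residual A b r c \<xi> 1 y $ i = 0"
  shows "m = 0"
proof -
  \<comment> \<open>Without net force the point \<open>y\<close> drops out, and the pairing of
    \<open>m\<close> with the residual at scale 1 is
    \<open>- (m \<bullet> (b - vec r))\<close>.\<close>
  have "m \<bullet> (b - vec r) = 0"
    using inner_complementary[OF assms(4)] assms(1)
    by (simp add: inner_halfspace_residual inner_diff_right)
      (simp add: inner_vec_def sum_distrib_left mult.commute)
  then have "(\<Sum>i\<in>UNIV. m $ i * (b - vec r) $ i) = 0"
    by (simp add: inner_vec_def)
  moreover have "0 \<le> m $ i * (b - vec r) $ i" for i
    using assms(2,3) by (metis less_eq_vec_def less_imp_le mult_nonneg_nonneg zero_index)
  ultimately have "m $ i * (b - vec r) $ i = 0" for i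
    by (subst (asm) sum_nonneg_eq_0_iff) auto
  then have "m $ i = 0" for i
    using assms(3) by (metis less_irrefl mult_eq_0_iff)
  then show ?thesis by (simp add: vec_eq_iff)
qed

context
  fixes A1 :: "real^2^'m" and b1 :: "real^'m" and A2 :: "real^2^'n" and b2 :: "real^'n"
    and r :: real and q :: "real^6"
begin

abbreviation "F1 \<equiv> force A1 (angle1 q)"
abbreviation "F2 \<equiv> force A2 (angle2 q)"
abbreviation "G1 \<equiv> halfspace_residual A1 b1 r (center1 q) (angle1 q)"
abbreviation "G2 \<equiv> halfspace_residual A2 b2 r (center2 q) (angle2 q)"

lemma lagrangian_eq:
  "lagrangian A1 b1 A2 b2 r q (p, \<alpha>, y1, y2) (m1, m2, k1, k2) =
     \<alpha> * (1 - m1 \<bullet> b1 - m2 \<bullet> b2) - 1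
     + F1 m1 \<bullet> (y1 - center1 q) + F2 m2 \<bullet> (y2 - center2 q)
     + r * ((\<Sum>i\<in>UNIV. m1 $ i) + (\<Sum>j\<in>UNIV. m2 $ j))
     + k1 * ((p - y1) \<bullet> (p - y1) - r\<^sup>2) + k2 * ((p - y2) \<bullet> (p - y2) - r\<^sup>2)"
  by (simp add: lagrangian_def objective_def inner_halfspace_residual ball_residual_def
      algebra_simps)

text \<open>The equations are the vanishing partial gradients of the Lagrangian in
  \<open>\<alpha>\<close>, \<open>y1\<close>, \<open>y2\<close> and \<open>p\<close>. The primal
  point enters only through \<open>u1 = p - y1\<close> and \<open>u2 = p - y2\<close>, so
  stationarity passes to every point with the same differences.\<close>

definition stationary :: "('m, 'n) multiplier \<Rightarrow> real^2 \<Rightarrow> real^2 \<Rightarrow> bool" where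
  "stationary = (\<lambda>(m1, m2, k1, k2) u1 u2.
     m1 \<bullet> b1 + m2 \<bullet> b2 = 1 \<and> F1 m1 = (2 * k1) *\<^sub>R u1 \<and> F2 m2 = (2 * k2) *\<^sub>R u2 \<and>
     k1 *\<^sub>R u1 + k2 *\<^sub>R u2 = 0)"

lemma lagrangian_has_derivative:
  "((\<lambda>z. lagrangian A1 b1 A2 b2 r q z (m1, m2, k1, k2)) has_derivative
     (\<lambda>(hp, ha, h1, h2). ha * (1 - m1 \<bullet> b1 - m2 \<bullet> b2) + F1 m1 \<bullet> h1 + F2 m2 \<bullet> h2
        + k1 * (2 * ((p - y1) \<bullet> (hp - h1))) + k2 * (2 * ((p - y2) \<bullet> (hp - h2)))))
   (at (p, \<alpha>, y1, y2))"
proof -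
  have L: "(\<lambda>z. lagrangian A1 b1 A2 b2 r q z (m1, m2, k1, k2)) = (\<lambda>z.
      fst (snd z) * (1 - m1 \<bullet> b1 - m2 \<bullet> b2) - 1
      + F1 m1 \<bullet> (fst (snd (snd z)) - center1 q) + F2 m2 \<bullet> (snd (snd (snd z)) - center2 q)
      + r * ((\<Sum>i\<in>UNIV. m1 $ i) + (\<Sum>j\<in>UNIV. m2 $ j))
      + k1 * ((fst z - fst (snd (snd z))) \<bullet> (fst z - fst (snd (snd z))) - r\<^sup>2)
      + k2 * ((fst z - snd (snd (snd z))) \<bullet> (fst z - snd (snd (snd z))) - r\<^sup>2))"
    by (rule ext) (auto simp: lagrangian_eq split: prod.split)
  show ?thesis
    unfolding L
    by (auto intro!: derivative_eq_intros simp: fun_eq_iff inner_commute)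
qed

lemma kkt_iff_stationary:
  "kkt A1 b1 A2 b2 r q (p, \<alpha>, y1, y2) \<mu> \<longleftrightarrow>
     stationary \<mu> (p - y1) (p - y2) \<and> (p, \<alpha>, y1, y2) \<in> feasible A1 b1 A2 b2 r q \<and>
     multiplier_nonneg \<mu> \<and> complementary A1 b1 A2 b2 r q (p, \<alpha>, y1, y2) \<mu>"
proof -
  obtain m1 m2 k1 k2 where \<mu>: "\<mu> = (m1, m2, k1, k2)" by (metis prod.exhaust)
  define D where "D = (\<lambda>(hp, ha, h1, h2). ha * (1 - m1 \<bullet> b1 - m2 \<bullet> b2) + F1 m1 \<bullet> h1 + F2 m2 \<bullet> h2
        + k1 * (2 * ((p - y1) \<bullet> (hp - h1))) + k2 * (2 * ((p - y2) \<bullet> (hp - h2))))"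
  have deriv: "((\<lambda>z. lagrangian A1 b1 A2 b2 r q z \<mu>) has_derivative D) (at (p, \<alpha>, y1, y2))"
    unfolding \<mu> D_def by (rule lagrangian_has_derivative)
  have "((\<lambda>z. lagrangian A1 b1 A2 b2 r q z \<mu>) has_derivative (\<lambda>_. 0)) (at (p, \<alpha>, y1, y2))
      \<longleftrightarrow> D = (\<lambda>_. 0)"
    using deriv has_derivative_unique by blast
  also have "\<dots> \<longleftrightarrow> stationary \<mu> (p - y1) (p - y2)"
  proof
    assume D0: "D = (\<lambda>_. 0)"
    have "D (0, 1, 0, 0) = 0" by (simp add: D0)
    then have 1: "m1 \<bullet> b1 + m2 \<bullet> b2 = 1" by (simp add: D_def)
    \<comment> \<open>Evaluating \<open>D\<close> along a multiple of a partial gradient yields a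
      multiple of its squared norm, so \<open>D = 0\<close> makes it vanish. The same device serves
      for \<open>w2\<close> and \<open>w\<close>.\<close>
    define w1 where "w1 = F1 m1 - (2 * k1) *\<^sub>R (p - y1)"
    have "D (0, 0, w1, 0) = w1 \<bullet> w1"
      by (subst (2) w1_def) (simp add: D_def inner_diff_left algebra_simps)
    then have 2: "F1 m1 = (2 * k1) *\<^sub>R (p - y1)" by (simp add: D0 w1_def)
    define w2 where "w2 = F2 m2 - (2 * k2) *\<^sub>R (p - y2)"
    have "D (0, 0, 0, w2) = w2 \<bullet> w2"
      by (subst (2) w2_def) (simp add: D_def inner_diff_left algebra_simps)
    then have 3: "F2 m2 = (2 * k2) *\<^sub>R (p - y2)" by (simp add: D0 w2_def)
    define w where "w = k1 *\<^sub>R (p - y1) + k2 *\<^sub>R (p - y2)"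
    have "D (w, 0, 0, 0) = 2 * (w \<bullet> w)"
      by (subst (2) w_def) (simp add: D_def inner_add_left)
    then have "k1 *\<^sub>R (p - y1) + k2 *\<^sub>R (p - y2) = 0" by (simp add: D0 w_def)
    with 1 2 3 show "stationary \<mu> (p - y1) (p - y2)" by (simp add: stationary_def \<mu>)
  next
    assume "stationary \<mu> (p - y1) (p - y2)"
    then have st: "m1 \<bullet> b1 + m2 \<bullet> b2 = 1" "F1 m1 = (2 * k1) *\<^sub>R (p - y1)"
      "F2 m2 = (2 * k2) *\<^sub>R (p - y2)" and "k1 *\<^sub>R (p - y1) + k2 *\<^sub>R (p - y2) = 0"
      by (simp_all add: stationary_def \<mu>)
    then have bal: "k1 * ((p - y1) \<bullet> h) + k2 * ((p - y2) \<bullet> h) = 0" for h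
      by (metis inner_add_left inner_scaleR_left inner_zero_left)
    have "D (hp, ha, h1, h2) = ha * (1 - (m1 \<bullet> b1 + m2 \<bullet> b2))
        + 2 * (k1 * ((p - y1) \<bullet> hp) + k2 * ((p - y2) \<bullet> hp))" for hp ha h1 h2
      unfolding D_def prod.case st(2,3) inner_scaleR_left inner_diff_right[of _ hp]
      by (simp add: algebra_simps)
    then show "D = (\<lambda>_. 0)" by (auto simp: fun_eq_iff bal st(1))
  qed
  finally show ?thesis by (simp add: kkt_def)
qed

text \<open>For fixed multipliers the Lagrangian is quadratic in the primal variables, so its
  expansion at a stationary point is exact and consists of the second-order part alone.\<close>

lemma lagrangian_increment:
  assumes "stationary (m1, m2, k1, k2) (p - y1) (p - y2)"
  shows "lagrangian A1 b1 A2 b2 r q (p', \<alpha>', y1', y2') (m1, m2, k1, k2)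
     - lagrangian A1 b1 A2 b2 r q (p, \<alpha>, y1, y2) (m1, m2, k1, k2)
     = k1 * (norm ((p' - y1') - (p - y1)))\<^sup>2 + k2 * (norm ((p' - y2') - (p - y2)))\<^sup>2"
proof -
  define u1 u2 u1' u2' where u: "u1 = p - y1" "u2 = p - y2" "u1' = p' - y1'" "u2' = p' - y2'"
  have y: "y1 = p - u1" "y2 = p - u2" "y1' = p' - u1'" "y2' = p' - u2'" by (simp_all add: u)
  have st: "1 - m1 \<bullet> b1 - m2 \<bullet> b2 = 0" "F1 m1 = (2 * k1) *\<^sub>R u1"
    "F2 m2 = (2 * k2) *\<^sub>R u2" and "k1 *\<^sub>R u1 + k2 *\<^sub>R u2 = 0"
    using assms by (simp_all add: stationary_def u)
  then have bal: "k2 * (u2 \<bullet> h) = - (k1 * (u1 \<bullet> h))" for h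
    by (metis add_eq_0_iff inner_add_left inner_scaleR_left inner_zero_left)
  \<comment> \<open>Completing the square for one body leaves a term linear in
    \<open>p' - p\<close>; the two such terms cancel by the force balance
    \<open>bal\<close>.\<close>
  have square: "(2 * k) *\<^sub>R u \<bullet> (p' - u' - c) + k * (u' \<bullet> u') =
      (2 * k) *\<^sub>R u \<bullet> (p - u - c) + k * (u \<bullet> u)
        + 2 * (k * (u \<bullet> (p' - p))) + k * ((u' - u) \<bullet> (u' - u))"
    for k c and u u' :: "real^2"
    by (simp add: inner_diff_left inner_diff_right inner_commute algebra_simps)
  have cancel: "x - (x - v) = v" for x v :: "real^2" by simp
  show ?thesis
    unfolding lagrangian_eq st y cancel power2_norm_eq_inner right_diff_distrib[of k1]
      right_diff_distrib[of k2] mult_zero_right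
    using square[of k1 u1 u1' "center1 q"] square[of k2 u2 u2' "center2 q"] bal[of "p' - p"]
    by linarith
qed

text \<open>By balance the two forces vanish together. If they did, \<open>force_eq_0D\<close> would
  give \<open>m1 = 0\<close> and \<open>m2 = 0\<close>, against the normalization
  \<open>m1 \<bullet> b1 + m2 \<bullet> b2 = 1\<close>.\<close>

lemma multipliers_pos:
  assumes kkt: "kkt A1 b1 A2 b2 r q (p, 1, y1, y2) (m1, m2, k1, k2)"
    and b1: "\<forall>i. 0 < (b1 - vec r) $ i" and b2: "\<forall>j. 0 < (b2 - vec r) $ j"
  shows "0 < k1" "0 < k2" "p - y1 \<noteq> 0"
proof -
  have st: "m1 \<bullet> b1 + m2 \<bullet> b2 = 1" "F1 m1 = (2 * k1) *\<^sub>R (p - y1)"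
      "F2 m2 = (2 * k2) *\<^sub>R (p - y2)" "k1 *\<^sub>R (p - y1) + k2 *\<^sub>R (p - y2) = 0"
    and nn: "0 \<le> m1" "0 \<le> m2" "0 \<le> k1" "0 \<le> k2"
    and co: "\<forall>i. m1 $ i * G1 1 y1 $ i = 0" "\<forall>j. m2 $ j * G2 1 y2 $ j = 0"
    using kkt by (auto simp: kkt_iff_stationary stationary_def multiplier_nonneg_def
        complementary_def)
  have "F1 m1 = 0 \<longleftrightarrow> F2 m2 = 0"
    using st by (auto simp: add_eq_0_iff)
  moreover have "F1 m1 \<noteq> 0 \<or> F2 m2 \<noteq> 0"
  proof (rule ccontr)
    assume "\<not> ?thesis"
    then have "m1 = 0" "m2 = 0"
      using force_eq_0D nn b1 b2 co by blast+
    then show False using st(1) by simp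
  qed
  ultimately have "F1 m1 \<noteq> 0" "F2 m2 \<noteq> 0" by auto
  then show "0 < k1" "0 < k2" "p - y1 \<noteq> 0" using st nn by auto
qed

text \<open>The Lagrangian is strictly convex in \<open>p - y1\<close> and \<open>p - y2\<close>, so all optimal points
  share these differences, and a multiplier for one of them is a multiplier for all.\<close>
lemma kkt_transfer:
  assumes kkt: "kkt A1 b1 A2 b2 r q (p, \<alpha>, y1, y2) (m1, m2, k1, k2)"
    and k: "0 < k1" "0 < k2"
    and feas: "(p', \<alpha>', y1', y2') \<in> feasible A1 b1 A2 b2 r q" and "\<alpha>' = \<alpha>"
  shows "p' - y1' = p - y1" "p' - y2' = p - y2" "F1 m1 \<bullet> (p' - p) = 0"
    "kkt A1 b1 A2 b2 r q (p', \<alpha>', y1', y2') (m1, m2, k1, k2)"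
proof -
  let ?L = "\<lambda>z. lagrangian A1 b1 A2 b2 r q z (m1, m2, k1, k2)"
  have st: "stationary (m1, m2, k1, k2) (p - y1) (p - y2)"
    and nn: "0 \<le> m1" "0 \<le> m2"
    and co: "\<forall>i. m1 $ i * G1 \<alpha> y1 $ i = 0" "\<forall>j. m2 $ j * G2 \<alpha> y2 $ j = 0"
      "k1 * ball_residual r p y1 = 0" "k2 * ball_residual r p y2 = 0"
    using kkt by (auto simp: kkt_iff_stationary multiplier_nonneg_def complementary_def)
  have fe: "G1 \<alpha>' y1' \<le> 0" "G2 \<alpha>' y2' \<le> 0" "ball_residual r p' y1' \<le> 0" "ball_residual r p' y2' \<le> 0"
    using feas by (auto simp: feasible_def)
  have L0: "?L (p, \<alpha>, y1, y2) = \<alpha> - 1"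
    using inner_complementary[OF co(1)] inner_complementary[OF co(2)] co(3,4)
    by (simp only: lagrangian_def objective_def prod.case)
  have L1: "?L (p', \<alpha>', y1', y2') = \<alpha> - 1 + m1 \<bullet> G1 \<alpha>' y1' + m2 \<bullet> G2 \<alpha>' y2'
      + k1 * ball_residual r p' y1' + k2 * ball_residual r p' y2'"
    by (simp add: lagrangian_def objective_def \<open>\<alpha>' = \<alpha>\<close>)
  have le: "m1 \<bullet> G1 \<alpha>' y1' \<le> 0" "m2 \<bullet> G2 \<alpha>' y2' \<le> 0"
    "k1 * ball_residual r p' y1' \<le> 0" "k2 * ball_residual r p' y2' \<le> 0"
    using nn fe k by (auto intro: inner_nonneg_nonpos mult_nonneg_nonpos)
  have ge: "0 \<le> k1 * (norm ((p' - y1') - (p - y1)))\<^sup>2" "0 \<le> k2 * (norm ((p' - y2') - (p - y2)))\<^sup>2"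
    using k by auto
  \<comment> \<open>At equal \<open>\<alpha>\<close> the increment is a sum of nonnegative squares
    and also a sum of nonpositive multiplier terms. Hence every summand on either side is 0.\<close>
  note inc = lagrangian_increment[OF st, of p' \<alpha>' y1' y2' \<alpha>] L0 L1
  have "k1 * (norm ((p' - y1') - (p - y1)))\<^sup>2 = 0" "k2 * (norm ((p' - y2') - (p - y2)))\<^sup>2 = 0"
    using inc le ge by linarith+
  then show u: "p' - y1' = p - y1" "p' - y2' = p - y2" using k by auto
  have zero: "m1 \<bullet> G1 \<alpha>' y1' = 0" "m2 \<bullet> G2 \<alpha>' y2' = 0"
    "k1 * ball_residual r p' y1' = 0" "k2 * ball_residual r p' y2' = 0"
    using inc le ge by linarith+
  then have "\<forall>i. m1 $ i * G1 \<alpha>' y1' $ i = 0" "\<forall>j. m2 $ j * G2 \<alpha>' y2' $ j = 0"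
    using nn fe by (intro allI inner_eq_0_componentwise; simp)+
  then show "kkt A1 b1 A2 b2 r q (p', \<alpha>', y1', y2') (m1, m2, k1, k2)"
    using kkt feas zero(3,4) by (simp add: kkt_iff_stationary u complementary_def)
  \<comment> \<open>Both pairings are 0, and at equal \<open>\<alpha>\<close> they differ only by
    the force applied to the shift of \<open>y1\<close>, which is the shift of
    \<open>p\<close>.\<close>
  have "m1 \<bullet> G1 \<alpha>' y1' = m1 \<bullet> G1 \<alpha> y1"
    using zero(1) co(1) by (simp add: inner_complementary)
  then have "F1 m1 \<bullet> (y1' - y1) = 0"
    by (simp add: inner_halfspace_residual \<open>\<alpha>' = \<alpha>\<close> inner_diff_right)
  moreover have "y1' - y1 = p' - p" using u(1) by (simp add: algebra_simps)
  ultimately show "F1 m1 \<bullet> (p' - p) = 0" by simp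
qed

end

section \<open>The set of optimal contact points\<close>

lemma halfspace_residual_le_0_eq:
  "{p. halfspace_residual A b r c \<xi> \<alpha> (p - u) \<le> 0} =
     (\<Inter>i. {p. force A \<xi> (axis i 1) \<bullet> p \<le> force A \<xi> (axis i 1) \<bullet> (u + c) + \<alpha> * b $ i - r})"
  by (auto simp: less_eq_vec_def halfspace_residual_nth inner_diff_right inner_add_right
      algebra_simps)

lemma closed_halfspace_residual: "closed {p. halfspace_residual A b r c \<xi> \<alpha> (p - u) \<le> 0}"
  unfolding halfspace_residual_le_0_eq by (intro closed_INT ballI closed_halfspace_le)

lemma convex_halfspace_residual: "convex {p. halfspace_residual A b r c \<xi> \<alpha> (p - u) \<le> 0}"
  unfolding halfspace_residual_le_0_eq by (intro convex_INT convex_halfspace_le)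

text \<open>At scale 1 the constraint describes the polytope tightened by \<open>r\<close>; as
  \<open>0 \<le> r\<close>, it lies in a rotated and translated copy of the bounded
  polytope.\<close>

lemma bounded_halfspace_residual:
  assumes "bounded {x. A *v x \<le> b}" "0 \<le> r"
  shows "bounded {p. halfspace_residual A b r c \<xi> 1 (p - u) \<le> 0}"
proof -
  let ?X = "{x. A *v x \<le> b}"
  have "bounded ((\<lambda>w. (u + c) + w) ` ((*v) (rot \<xi>)) ` ?X)"
    using assms(1) by (intro bounded_translation bounded_linear_image)
      (auto simp: linear_conv_bounded_linear[symmetric])
  moreover have "{p. halfspace_residual A b r c \<xi> 1 (p - u) \<le> 0} \<subseteq>
      (\<lambda>w. (u + c) + w) ` ((*v) (rot \<xi>)) ` ?X"
  proof
    fix p assume "p \<in> {p. halfspace_residual A b r c \<xi> 1 (p - u) \<le> 0}"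
    then have le: "halfspace_residual A b r c \<xi> 1 (p - u) \<le> 0" by simp
    define x where "x = transpose (rot \<xi>) *v (p - u - c)"
    have "(A *v x) $ i \<le> b $ i" for i
    proof -
      have "halfspace_residual A b r c \<xi> 1 (p - u) $ i \<le> 0"
        using le by (simp add: less_eq_vec_def)
      then show ?thesis
        using assms(2) by (simp add: halfspace_residual_def x_def del: transpose_matrix_vector)
    qed
    then have "x \<in> ?X" by (simp add: less_eq_vec_def)
    moreover have "p = (u + c) + rot \<xi> *v x"
      unfolding x_def rot_transpose_mult by simp
    ultimately show "p \<in> (\<lambda>w. (u + c) + w) ` ((*v) (rot \<xi>)) ` ?X" by blast
  qed
  ultimately show ?thesis by (rule bounded_subset)
qed

section \<open>The impact law\<close>

text \<open>A monotonicity argument: testing each velocity against the other's normal makes the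
  inner product of the impulse difference and the velocity difference nonpositive. It is also the
  squared norm of \<open>S\<close> applied to the impulse difference, and \<open>S\<close> is
  injective.\<close>

lemma impact_velocity_unique:
  assumes S: "linear S" "inj S" "\<And>x y. S x \<bullet> y = x \<bullet> S y"
    "\<And>x. matrix_inv M *v x = S (S x)"
    and law: "impact_law A1 b1 A2 b2 r M q \<nu> \<nu>1 \<Lambda>1 z1 \<mu>1"
      "impact_law A1 b1 A2 b2 r M q \<nu> \<nu>2 \<Lambda>2 z2 \<mu>2"
  shows "\<nu>1 = \<nu>2"
    "\<Lambda>1 *\<^sub>R contact_normal A1 z1 \<mu>1 q = \<Lambda>2 *\<^sub>R contact_normal A1 z2 \<mu>2 q"
proof -
  interpret linear S by fact
  define n1 n2 where n: "n1 = contact_normal A1 z1 \<mu>1 q" "n2 = contact_normal A1 z2 \<mu>2 q"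
  define x where "x = S (\<Lambda>1 *\<^sub>R n1 - \<Lambda>2 *\<^sub>R n2)"
  have l: "0 \<le> \<Lambda>1" "0 \<le> \<Lambda>2" "n1 \<bullet> \<nu>1 = 0" "n2 \<bullet> \<nu>2 = 0" "0 \<le> n1 \<bullet> \<nu>2" "0 \<le> n2 \<bullet> \<nu>1"
    and v: "\<nu>1 = \<nu> + S (S (\<Lambda>1 *\<^sub>R n1))" "\<nu>2 = \<nu> + S (S (\<Lambda>2 *\<^sub>R n2))"
    using law unfolding impact_law_def S(4) n scale by metis+
  have "\<nu>1 - \<nu>2 = S x" unfolding v x_def by (simp add: diff)
  then have "x \<bullet> x = (\<Lambda>1 *\<^sub>R n1 - \<Lambda>2 *\<^sub>R n2) \<bullet> (\<nu>1 - \<nu>2)"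
    by (simp add: x_def S(3))
  also have "\<dots> = - (\<Lambda>1 * (n1 \<bullet> \<nu>2)) - \<Lambda>2 * (n2 \<bullet> \<nu>1)"
    using l by (simp add: inner_diff_left inner_diff_right)
  also have "\<dots> \<le> 0"
    using mult_nonneg_nonneg[OF l(1,5)] mult_nonneg_nonneg[OF l(2,6)] by linarith
  finally have "x = 0" by (metis inner_eq_zero_iff inner_ge_zero order_antisym)
  then show "\<nu>1 = \<nu>2" using \<open>\<nu>1 - \<nu>2 = S x\<close> by (simp add: zero)
  have "S (\<Lambda>1 *\<^sub>R n1 - \<Lambda>2 *\<^sub>R n2) = S 0" using \<open>x = 0\<close> by (simp add: x_def zero)
  then have "\<Lambda>1 *\<^sub>R n1 - \<Lambda>2 *\<^sub>R n2 = 0" using S(2) by (rule injD[rotated])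
  then show "\<Lambda>1 *\<^sub>R contact_normal A1 z1 \<mu>1 q = \<Lambda>2 *\<^sub>R contact_normal A1 z2 \<mu>2 q"
    by (simp add: n)
qed

lemma n_tr_eq_force: "n_tr A1 (m1, m2, k1, k2) q = - force A1 (angle1 q) m1"
  by (simp add: n_tr_def force_def del: transpose_matrix_vector)

lemma optimal_alpha:
  assumes "\<Phi> A1 b1 A2 b2 r q = 0" "solves A1 b1 A2 b2 r q (p, \<alpha>, y1, y2) \<mu>"
  shows "\<alpha> = 1"
proof -
  let ?F = "feasible A1 b1 A2 b2 r q"
  have F: "(p, \<alpha>, y1, y2) \<in> ?F" "\<forall>z'\<in>?F. objective (p, \<alpha>, y1, y2) \<le> objective z'"
    using assms(2) by (auto simp: solves_def primal_optimal_def)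
  then have "\<Phi> A1 b1 A2 b2 r q = objective (p, \<alpha>, y1, y2)"
    unfolding \<Phi>_def by (intro cInf_eq_minimum) auto
  then show ?thesis using assms(1) by (simp add: objective_def)
qed

theorem mainTheorem4:
  fixes A1 :: "real^2^'m" and b1 :: "real^'m"
    and A2 :: "real^2^'n" and b2 :: "real^'n"
    and r :: real and M :: "real^6^6" and q \<nu>_pre :: "real^6"
  assumes bounded1: "bounded {x. A1 *v x \<le> b1}"
    and bounded2: "bounded {x. A2 *v x \<le> b2}"
    and unit1: "\<forall>i. norm (row i A1) = 1"
    and unit2: "\<forall>j. norm (row j A2) = 1"
    and r_pos: "0 < r"
    and b1_r: "\<forall>i. 0 < (b1 - vec r) $ i"
    and b2_r: "\<forall>j. 0 < (b2 - vec r) $ j"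
    and nondeg: "nondegenerate A1 b1 A2 b2 r q"
    and inertia: "diagonal_posdef M"
    and contact: "\<Phi> A1 b1 A2 b2 r q = 0"
    and approaching: "\<exists>z \<mu>. solves A1 b1 A2 b2 r q z \<mu> \<and> contact_normal A1 z \<mu> q \<bullet> \<nu>_pre < 0"
  shows "(\<exists>!\<nu>_post. \<exists>\<Lambda> z \<mu>. impact_law A1 b1 A2 b2 r M q \<nu>_pre \<nu>_post \<Lambda> z \<mu>) \<and>
    (\<exists>!z. \<exists>\<nu>_post \<Lambda> \<mu>. impact_law A1 b1 A2 b2 r M q \<nu>_pre \<nu>_post \<Lambda> z \<mu>) \<and>
    (\<exists>!p. \<exists>\<nu>_post \<Lambda> \<alpha> y1 y2 \<mu>.
       impact_law A1 b1 A2 b2 r M q \<nu>_pre \<nu>_post \<Lambda> (p, \<alpha>, y1, y2) \<mu>)"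
proof -
  let ?solves = "solves A1 b1 A2 b2 r q"
  let ?law = "impact_law A1 b1 A2 b2 r M q \<nu>_pre"
  obtain S :: "real^6 \<Rightarrow> real^6" where S: "linear S" "inj S" "\<And>x y. S x \<bullet> y = x \<bullet> S y"
    "\<And>x. matrix_inv M *v x = S (S x)"
    using diagonal_posdef_inv_sqrt[OF inertia] by metis

  obtain p0 \<alpha>0 y1 y2 m1 m2 k1 k2
    where solves0': "?solves (p0, \<alpha>0, y1, y2) (m1, m2, k1, k2)"
      and neg': "contact_normal A1 (p0, \<alpha>0, y1, y2) (m1, m2, k1, k2) q \<bullet> \<nu>_pre < 0"
    using approaching by (metis prod.exhaust)
  have "\<alpha>0 = 1" using optimal_alpha[OF contact solves0'] .
  note solves0 = solves0'[unfolded this] and neg = neg'[unfolded this]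
  define \<mu>0 where "\<mu>0 = (m1, m2, k1, k2)"
  define u1 u2 where u: "u1 = p0 - y1" "u2 = p0 - y2"
  have kkt0: "kkt A1 b1 A2 b2 r q (p0, 1, y1, y2) (m1, m2, k1, k2)"
    and opt0: "primal_optimal A1 b1 A2 b2 r q (p0, 1, y1, y2)"
    and dual0: "dual_optimal A1 b1 A2 b2 r q (m1, m2, k1, k2)"
    using solves0 by (auto simp: solves_def)
  have k: "0 < k1" "0 < k2" and "u1 \<noteq> 0"
    using multipliers_pos[OF kkt0 b1_r b2_r] by (auto simp: u)
  \<comment> \<open>The direction \<open>n_tr\<close> of the approaching solution serves as
    reference; any other solution has this direction scaled by \<open>k1' / k1\<close>, since both
    forces are positive multiples of \<open>u1\<close>.\<close>
  define t where "t = - ((2 * k1) *\<^sub>R u1)"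
  have "t \<noteq> 0" using k \<open>u1 \<noteq> 0\<close> by (simp add: t_def)
  have F0: "force A1 (angle1 q) m1 = (2 * k1) *\<^sub>R u1"
    using kkt0 by (simp add: kkt_iff_stationary stationary_def u)
  have t0: "n_tr A1 \<mu>0 q = t"
    by (simp add: \<mu>0_def n_tr_eq_force F0 t_def)

  \<comment> \<open>The optimal contact points: with \<open>\<alpha> = 1\<close> and the differences
    \<open>u1\<close>, \<open>u2\<close> fixed, feasibility already gives optimality.\<close>
  define P where "P = {p. (p, 1, p - u1, p - u2) \<in> feasible A1 b1 A2 b2 r q}"
  have solvesP: "?solves (p, 1, p - u1, p - u2) \<mu>0" if "p \<in> P" for p
  proof -
    have feas: "(p, 1, p - u1, p - u2) \<in> feasible A1 b1 A2 b2 r q"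
      using that by (simp add: P_def)
    then show ?thesis
      using kkt_transfer(4)[OF kkt0 k feas refl] opt0 dual0
      by (simp add: \<mu>0_def solves_def primal_optimal_def objective_def)
  qed
  have all_solutions: "\<exists>p s. z = (p, 1, p - u1, p - u2) \<and> p \<in> P \<and> (p - p0) \<bullet> t = 0 \<and>
      0 < s \<and> n_tr A1 \<mu> q = s *\<^sub>R t" if sol: "?solves z \<mu>" for z \<mu>
  proof -
    obtain p \<alpha> y1' y2' m1' m2' k1' k2' where z': "z = (p, \<alpha>, y1', y2')"
      and \<mu>: "\<mu> = (m1', m2', k1', k2')"
      by (metis prod.exhaust)
    have "\<alpha> = 1" using optimal_alpha[OF contact sol[unfolded z']] .
    then have z: "z = (p, 1, y1', y2')" by (simp add: z')
    have kkt: "kkt A1 b1 A2 b2 r q (p, 1, y1', y2') (m1', m2', k1', k2')"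
      and feas: "(p, 1, y1', y2') \<in> feasible A1 b1 A2 b2 r q"
      using sol by (auto simp: solves_def z \<mu> primal_optimal_def)
    note tr = kkt_transfer[OF kkt0 k feas refl]
    have y: "y1' = p - u1" "y2' = p - u2" using tr(1,2) by (simp_all add: u algebra_simps)
    have "p \<in> P" using feas by (simp add: P_def y)
    moreover have "(p - p0) \<bullet> t = 0"
      using tr(3) by (simp add: F0 t_def inner_commute)
    moreover have "0 < k1' / k1"
      using multipliers_pos(1)[OF kkt b1_r b2_r] k by simp
    moreover have "n_tr A1 \<mu> q = (k1' / k1) *\<^sub>R t"
      using kkt k by (simp add: \<mu> n_tr_eq_force kkt_iff_stationary stationary_def y t_def)
    ultimately show ?thesis using y z by blast
  qed

  have "p0 \<in> P" using opt0 by (simp add: P_def u primal_optimal_def)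
  \<comment> \<open>The ball residuals depend only on \<open>u1\<close> and \<open>u2\<close>, so
    feasibility at \<open>p0\<close> settles them for every \<open>p\<close>, and \<open>P\<close>
    is cut out by halfspaces alone.\<close>
  then have ball: "ball_residual r p (p - u1) \<le> 0" "ball_residual r p (p - u2) \<le> 0" for p
    by (auto simp: P_def feasible_def ball_residual_def)
  have P_eq: "P = {p. halfspace_residual A1 b1 r (center1 q) (angle1 q) 1 (p - u1) \<le> 0} \<inter>
      {p. halfspace_residual A2 b2 r (center2 q) (angle2 q) 1 (p - u2) \<le> 0}"
    using ball by (auto simp: P_def feasible_def)
  have "closed P"
    unfolding P_eq by (intro closed_Int closed_halfspace_residual)
  moreover have "bounded P"
    unfolding P_eq using bounded_halfspace_residual[OF bounded1 less_imp_le[OF r_pos]]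
    by (rule bounded_subset) (rule Int_lower1)
  ultimately have "compact P" by (simp add: compact_eq_bounded_closed)
  have "convex P"
    unfolding P_eq by (intro convex_Int convex_halfspace_residual)

  \<comment> \<open>All normals are positive multiples of values of \<open>W\<close> on
    \<open>P\<close>, so existence can be settled with the single multiplier
    \<open>\<mu>0\<close>.\<close>
  define W where "W = wrench (center1 q) (center2 q) t"
  have normalP: "contact_normal A1 (p, z) \<mu>0 q = W p" for p z
    by (simp add: contact_normal_eq_wrench W_def t0)
  have "0 \<notin> W ` P"
    using wrench_eq_0D \<open>t \<noteq> 0\<close> unfolding W_def by (metis imageE)
  moreover have "W ` P \<noteq> {}" using \<open>p0 \<in> P\<close> by blast
  ultimately obtain \<Lambda> w where w: "0 \<le> \<Lambda>" "w \<in> W ` P"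
    "\<Lambda> * (w \<bullet> (\<nu>_pre + \<Lambda> *\<^sub>R S (S w))) = 0"
    "\<And>w'. w' \<in> W ` P \<Longrightarrow> 0 \<le> w' \<bullet> (\<nu>_pre + \<Lambda> *\<^sub>R S (S w))"
    using impulse_exists[OF S(1-3) compact_wrench_image[OF \<open>compact P\<close>]
        convex_wrench_image[OF \<open>convex P\<close>]] unfolding W_def by metis
  obtain p where p: "p \<in> P" "w = W p" using w(2) by blast
  have neg_W: "W p0 \<bullet> \<nu>_pre < 0"
    using neg normalP[of p0] by (simp flip: \<mu>0_def)
  \<comment> \<open>A zero impulse would make the approaching normal velocity at \<open>p0\<close>
    nonnegative. Being nonzero, \<open>\<Lambda>\<close> can be cancelled from the complementarity
    condition.\<close>
  have "\<Lambda> \<noteq> 0"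
    using w(4)[OF imageI[OF \<open>p0 \<in> P\<close>]] neg_W by auto
  define \<nu> where "\<nu> = \<nu>_pre + \<Lambda> *\<^sub>R S (S w)"
  have exists: "?law \<nu> \<Lambda> (p, 1, p - u1, p - u2) \<mu>0"
    unfolding impact_law_def
  proof (intro conjI allI impI)
    fix z' \<mu>' assume "?solves z' \<mu>'"
    from all_solutions[OF this] obtain p' s where "fst z' = p'" "p' \<in> P" "0 < s"
      "n_tr A1 \<mu>' q = s *\<^sub>R t" by auto
    then show "0 \<le> contact_normal A1 z' \<mu>' q \<bullet> \<nu>"
      using w(4)[of "W p'"]
      by (simp add: contact_normal_eq_wrench wrench_scaleR \<nu>_def flip: W_def)
  qed (use w p \<open>\<Lambda> \<noteq> 0\<close> solvesP in \<open>auto simp: normalP \<nu>_def S(4)\<close>)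

  have unique: "\<nu>1 = \<nu>2" "z1 = z2" if law: "?law \<nu>1 \<Lambda>1 z1 \<mu>1" "?law \<nu>2 \<Lambda>2 z2 \<mu>2"
    for \<nu>1 \<nu>2 \<Lambda>1 \<Lambda>2 z1 z2 \<mu>1 \<mu>2
  proof -
    note uniq = impact_velocity_unique[OF S law]
    show "\<nu>1 = \<nu>2" by (rule uniq(1))
    from law have "?solves z1 \<mu>1" "?solves z2 \<mu>2" by (simp_all add: impact_law_def)
    then obtain p1 s1 p2 s2 where
      1: "z1 = (p1, 1, p1 - u1, p1 - u2)" "(p1 - p0) \<bullet> t = 0" "0 < s1" "n_tr A1 \<mu>1 q = s1 *\<^sub>R t"
      and 2: "z2 = (p2, 1, p2 - u1, p2 - u2)" "(p2 - p0) \<bullet> t = 0" "n_tr A1 \<mu>2 q = s2 *\<^sub>R t"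
      using all_solutions by meson
    have "\<Lambda>1 \<noteq> 0"
    proof
      assume "\<Lambda>1 = 0"
      then have "\<nu>1 = \<nu>_pre" using law(1) by (simp add: impact_law_def)
      then have "0 \<le> contact_normal A1 (p0, 1, y1, y2) (m1, m2, k1, k2) q \<bullet> \<nu>_pre"
        using law(1) solves0 by (simp add: impact_law_def)
      then show False using neg by simp
    qed
    \<comment> \<open>The multiplier scales \<open>s1\<close> and \<open>s2\<close> are absorbed
      into the impulses, so equal impulses become equal wrenches at possibly different
      points.\<close>
    have "wrench (center1 q) (center2 q) ((\<Lambda>1 * s1) *\<^sub>R t) p1 =
        wrench (center1 q) (center2 q) ((\<Lambda>2 * s2) *\<^sub>R t) p2"
      using uniq(2) by (simp add: contact_normal_eq_wrench 1 2 wrench_scaleR)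
    then have "cross2 (p1 - p2) ((\<Lambda>1 * s1) *\<^sub>R t) = 0" by (rule wrench_inj(2))
    then have "cross2 (p1 - p2) t = 0"
      using \<open>\<Lambda>1 \<noteq> 0\<close> 1(3) by (simp add: cross2_scaleR_right)
    moreover have "(p1 - p2) \<bullet> t = 0"
      using 1(2) 2(2) by (simp add: inner_diff_left)
    ultimately have "p1 - p2 = 0" using \<open>t \<noteq> 0\<close> by (rule cross2_inner_eq_0)
    then show "z1 = z2" by (simp add: 1 2)
  qed

  show ?thesis
  proof (intro conjI)
    show "\<exists>!\<nu>_post. \<exists>\<Lambda> z \<mu>. ?law \<nu>_post \<Lambda> z \<mu>"
      using exists unique(1) by blast
    show "\<exists>!z. \<exists>\<nu>_post \<Lambda> \<mu>. ?law \<nu>_post \<Lambda> z \<mu>"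
      using exists unique(2) by blast
    show "\<exists>!p. \<exists>\<nu>_post \<Lambda> \<alpha> y1 y2 \<mu>. ?law \<nu>_post \<Lambda> (p, \<alpha>, y1, y2) \<mu>"
      using exists unique(2) by blast
  qed
qed

end
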